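(* There exists a monotonically growing temporal cycle $\mathcal{C}$ (that is, a monotonically growing temporal graph whose underlying static graph is a cycle) such that there is no Nash equilibrium in the two-player reverse temporal Voronoi game $\mathrm{rVor}(\mathcal{C},2)$.
   Context: A temporal graph $\mathcal{G}=(V,(E_t)_{t=1}^\infty)$ consists of a finite nonempty vertex set $V$ and an infinite sequence of edge sets $E_t\subseteq\binom{V}{2}$; it is assumed that the sequence is eventually constant (finite lifetime), i.e. there is $\tau$ with $E_t=E_\tau$ for all $t\ge\tau$. The underlying static graph is $(V,\bigcup_{t\ge1}E_t)$. A temporal cycle is a temporal graph whose underlying graph is a cycle. $\mathcal{G}$ is monotonically growing if $E_t\subseteq E_{t+1}$ for all $t\ge 1$. A temporal walk from $u$ to $v$ is a sequence $(\{v_0=u,v_1\},t_1),(\{v_1,v_2\},t_2),\dots,(\{v_{d-1},v_d=v\},t_d)$ with $t_i<t_{i+1}$ for all $i\in\{1,\dots,d-1\}$ (strictly increasing times) and $\{v_{i-1},v_i\}\in E_{t_i}$ for all $i\in\{1,\dots,d\}$; its arrival time is $t_d$. The temporal distance $\mathrm{td}(u,v)$ is the minimum arrival time of a temporal walk from $u$ to $v$, with $\mathrm{td}(u,u)=0$ and $\mathrm{td}(u,v)=\infty$ if there is no such walk. In the two-player reverse temporal Voronoi game $\mathrm{rVor}(\mathcal{G},2)$, each player $i\in\{1,2\}$ selects one vertex $p_i\in V$ (equal choices are allowed). Player $i$ wins the set $U_i(p_1,p_2)=\{v\in V\mid \mathrm{td}(v,p_i)<\mathrm{td}(v,p_j)\}$,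 where $j\ne i$ is the other player, and her payoff is $u_i(p_1,p_2)=|U_i(p_1,p_2)|$. A profile $(p_1,p_2)\in V^2$ is a Nash equilibrium if $u_1(p',p_2)\le u_1(p_1,p_2)$ and $u_2(p_1,p')\le u_2(p_1,p_2)$ for all $p'\in V$. *)

theory Defs
  imports Main "HOL-Library.Extended_Nat"
begin

text \<open>
  A temporal graph is given by a vertex set \<open>V\<close> and an edge sequence \<open>E\<close>, where edges are
  two-element vertex sets. Time steps start at 1; the value \<open>E 0\<close> is irrelevant, and no
  definition below depends on it.
\<close>

locale temporal_graph =
  fixes V :: "'a set" and E :: "nat \<Rightarrow> 'a set set"
  assumes finite_vertices: "finite V"
    and vertices_nonempty: "V \<noteq> {}"
    and edges: "\<And>t. t \<ge> 1 \<Longrightarrow> E t \<subseteq> {e. e \<subseteq> V \<and> card e = 2}"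
    and finite_lifetime: "\<exists>\<tau>\<ge>1. \<forall>t\<ge>\<tau>. E t = E \<tau>"

definition underlying_edges :: "(nat \<Rightarrow> 'a set set) \<Rightarrow> 'a set set" where
  "underlying_edges E = (\<Union>t\<in>{1..}. E t)"

definition is_cycle_graph :: "'a set \<Rightarrow> 'a set set \<Rightarrow> bool" where
  "is_cycle_graph V F \<longleftrightarrow>
     (\<exists>vs. distinct vs \<and> length vs \<ge> 3 \<and> set vs = V \<and>
       F = {{vs ! i, vs ! (Suc i mod length vs)} | i. i < length vs})"

definition temporal_cycle :: "'a set \<Rightarrow> (nat \<Rightarrow> 'a set set) \<Rightarrow> bool" where
  "temporal_cycle V E \<longleftrightarrow> temporal_graph V E \<and> is_cycle_graph V (underlying_edges E)"

definition monotonically_growing :: "(nat \<Rightarrow> 'a set set) \<Rightarrow> bool" where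
  "monotonically_growing E \<longleftrightarrow> (\<forall>t\<ge>1. E t \<subseteq> E (Suc t))"

text \<open>
  A walk is the nonempty list of its time edges \<open>({v\<^sub>i\<^sub>-\<^sub>1, v\<^sub>i}, t\<^sub>i)\<close>; the list \<open>vs\<close> is
  \<open>v\<^sub>0, \<dots>, v\<^sub>d\<close>. The trivial walk has no arrival time, so the distance from a vertex to itself
  is set to 0 separately. An infimum over no walks is \<open>\<infinity>\<close>.
\<close>

definition temporal_walk ::
  "(nat \<Rightarrow> 'a set set) \<Rightarrow> 'a \<Rightarrow> 'a \<Rightarrow> ('a set \<times> nat) list \<Rightarrow> bool" where
  "temporal_walk E u v w \<longleftrightarrow> w \<noteq> [] \<and>
     (\<exists>vs. length vs = Suc (length w) \<and> hd vs = u \<and> last vs = v \<and>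
       (\<forall>i<length w. fst (w ! i) = {vs ! i, vs ! Suc i} \<and>
          1 \<le> snd (w ! i) \<and> fst (w ! i) \<in> E (snd (w ! i)))) \<and>
     (\<forall>i. Suc i < length w \<longrightarrow> snd (w ! i) < snd (w ! Suc i))"

definition arrival_time :: "('a set \<times> nat) list \<Rightarrow> nat" where
  "arrival_time w = snd (last w)"

definition temporal_dist :: "(nat \<Rightarrow> 'a set set) \<Rightarrow> 'a \<Rightarrow> 'a \<Rightarrow> enat" where
  "temporal_dist E u v =
     (if u = v then 0 else (INF w\<in>{w. temporal_walk E u v w}. enat (arrival_time w)))"

text \<open>
  The game is symmetric, so both players' payoffs are given by one function of the player's own
  vertex \<open>p\<close> and the opponent's vertex \<open>q\<close>: in a profile \<open>(p\<^sub>1, p\<^sub>2)\<close>, player 1 gets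
  \<open>rvor_payoff V E p\<^sub>1 p\<^sub>2\<close> and player 2 gets \<open>rvor_payoff V E p\<^sub>2 p\<^sub>1\<close>. Distances are measured
  from the contested vertex towards the players.
\<close>

definition rvor_won :: "'a set \<Rightarrow> (nat \<Rightarrow> 'a set set) \<Rightarrow> 'a \<Rightarrow> 'a \<Rightarrow> 'a set" where
  "rvor_won V E p q = {v \<in> V. temporal_dist E v p < temporal_dist E v q}"

definition rvor_payoff :: "'a set \<Rightarrow> (nat \<Rightarrow> 'a set set) \<Rightarrow> 'a \<Rightarrow> 'a \<Rightarrow> nat" where
  "rvor_payoff V E p q = card (rvor_won V E p q)"

definition rvor_nash :: "'a set \<Rightarrow> (nat \<Rightarrow> 'a set set) \<Rightarrow> 'a \<Rightarrow> 'a \<Rightarrow> bool" where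
  "rvor_nash V E p\<^sub>1 p\<^sub>2 \<longleftrightarrow> p\<^sub>1 \<in> V \<and> p\<^sub>2 \<in> V \<and>
     (\<forall>p'\<in>V. rvor_payoff V E p' p\<^sub>2 \<le> rvor_payoff V E p\<^sub>1 p\<^sub>2) \<and>
     (\<forall>p'\<in>V. rvor_payoff V E p' p\<^sub>1 \<le> rvor_payoff V E p\<^sub>2 p\<^sub>1)"

end

theory Submission
  imports Defs
begin

text \<open>
  Take the 5-cycle on \<open>0, \<dots>, 4\<close> in which \<open>{1, 2}\<close> and \<open>{3, 4}\<close> appear at time 1, \<open>{2, 3}\<close> at
  time 2, and \<open>{0, 1}\<close> and \<open>{0, 4}\<close> at time 3. The best responses to \<open>0\<close> are \<open>2\<close> and \<open>3\<close>, and
  the unique best responses to the other vertices run \<open>1 \<rightarrow> 2 \<rightarrow> 4 \<rightarrow> 3 \<rightarrow> 1\<close>, so no two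
  vertices are best responses to each other. A temporal distance is bounded from above by an
  explicit walk, and from below by a potential that no time edge violates.
\<close>

lemma temporal_walk_single:
  assumes "{u, v} \<in> E t" "1 \<le> t"
  shows "temporal_walk E u v [({u, v}, t)]"
  unfolding temporal_walk_def using assms
  by (auto intro!: exI[of _ "[u, v]"])

lemma temporal_walk_snoc:
  assumes w: "temporal_walk E u v w" and e: "{v, x} \<in> E t" and t: "arrival_time w < t"
  shows "temporal_walk E u x (w @ [({v, x}, t)])"
proof -
  from w obtain vs where ne: "w \<noteq> []"
    and vs: "length vs = Suc (length w)" "hd vs = u" "last vs = v"
    and edge: "\<forall>i<length w. fst (w ! i) = {vs ! i, vs ! Suc i} \<and>
          1 \<le> snd (w ! i) \<and> fst (w ! i) \<in> E (snd (w ! i))"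
    and inc: "\<forall>i. Suc i < length w \<longrightarrow> snd (w ! i) < snd (w ! Suc i)"
    unfolding temporal_walk_def by blast
  have v: "vs ! length w = v"
    using vs by (metis diff_Suc_1 last_conv_nth length_0_conv nat.distinct(1))
  have last: "snd (w ! (length w - 1)) < t"
    using t ne by (simp add: arrival_time_def last_conv_nth)
  have "\<forall>i<length (w @ [({v, x}, t)]). fst ((w @ [({v, x}, t)]) ! i) = {(vs @ [x]) ! i, (vs @ [x]) ! Suc i} \<and>
          1 \<le> snd ((w @ [({v, x}, t)]) ! i) \<and> fst ((w @ [({v, x}, t)]) ! i) \<in> E (snd ((w @ [({v, x}, t)]) ! i))"
  proof (intro allI impI)
    fix i assume "i < length (w @ [({v, x}, t)])"
    then consider "i < length w" | "i = length w"
      by (auto simp: less_Suc_eq)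
    then show "fst ((w @ [({v, x}, t)]) ! i) = {(vs @ [x]) ! i, (vs @ [x]) ! Suc i} \<and>
          1 \<le> snd ((w @ [({v, x}, t)]) ! i) \<and> fst ((w @ [({v, x}, t)]) ! i) \<in> E (snd ((w @ [({v, x}, t)]) ! i))"
    proof cases
      case 1
      with vs(1) have "(vs @ [x]) ! i = vs ! i" "(vs @ [x]) ! Suc i = vs ! Suc i"
        "(w @ [({v, x}, t)]) ! i = w ! i"
        by (simp_all add: nth_append)
      with edge 1 show ?thesis
        by metis
    next
      \<comment> \<open>The new edge is used at a positive time because \<open>t\<close> exceeds an
        arrival time.\<close>
      case 2
      with v vs(1) e t show ?thesis
        by (simp add: nth_append)
    qed
  qed
  moreover have "\<forall>i. Suc i < length (w @ [({v, x}, t)]) \<longrightarrow>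
      snd ((w @ [({v, x}, t)]) ! i) < snd ((w @ [({v, x}, t)]) ! Suc i)"
    using inc last by (auto simp: nth_append less_Suc_eq) (metis One_nat_def diff_Suc_1)
  ultimately show ?thesis
    unfolding temporal_walk_def using vs
    by (intro conjI exI[of _ "vs @ [x]"]) (auto simp: hd_append)
qed

text \<open>Forgets the walk and keeps its exact arrival time, so that walks can be built edge by
  edge.\<close>

definition reaches_at :: "(nat \<Rightarrow> 'a set set) \<Rightarrow> 'a \<Rightarrow> 'a \<Rightarrow> nat \<Rightarrow> bool" where
  "reaches_at E u v t \<longleftrightarrow> (\<exists>w. temporal_walk E u v w \<and> arrival_time w = t)"

lemma reaches_at_edge: "{u, v} \<in> E t \<Longrightarrow> 1 \<le> t \<Longrightarrow> reaches_at E u v t"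
  unfolding reaches_at_def
  by (intro exI[of _ "[({u, v}, t)]"]) (simp add: temporal_walk_single arrival_time_def)

lemma reaches_at_step:
  assumes "reaches_at E u v s" "{v, x} \<in> E t" "s < t"
  shows "reaches_at E u x t"
proof -
  from assms(1) obtain w where "temporal_walk E u v w" "arrival_time w = s"
    unfolding reaches_at_def by blast
  with assms show ?thesis
    unfolding reaches_at_def
    by (intro exI[of _ "w @ [({v, x}, t)]"]) (simp add: temporal_walk_snoc arrival_time_def)
qed

text \<open>By induction along the walk, no vertex is entered before its potential. As times
  strictly increase, the next edge is used strictly after that, which is the premise of
  \<open>step\<close>; at the start, \<open>f u = 0\<close> and \<open>1 \<le> t\<close> supply
  it.\<close>

lemma potential_le_arrival_time:
  assumes w: "temporal_walk E u v w" and "f u = 0"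
    and step: "\<And>x y t. 1 \<le> t \<Longrightarrow> {x, y} \<in> E t \<Longrightarrow> f x < t \<Longrightarrow> f y \<le> t"
  shows "f v \<le> arrival_time w"
proof -
  from w obtain vs where ne: "w \<noteq> []"
    and vs: "length vs = Suc (length w)" "hd vs = u" "last vs = v"
    and edge: "\<And>i. i < length w \<Longrightarrow> 1 \<le> snd (w ! i)"
      "\<And>i. i < length w \<Longrightarrow> {vs ! i, vs ! Suc i} \<in> E (snd (w ! i))"
    and inc: "\<And>i. Suc i < length w \<Longrightarrow> snd (w ! i) < snd (w ! Suc i)"
    unfolding temporal_walk_def by metis
  have u: "vs ! 0 = u"
    using vs by (metis hd_conv_nth length_0_conv nat.distinct(1))
  have v: "vs ! length w = v"
    using vs by (metis diff_Suc_1 last_conv_nth length_0_conv nat.distinct(1))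
  have "f (vs ! Suc i) \<le> snd (w ! i)" if "i < length w" for i
    using that
  proof (induction i)
    case 0
    then show ?case
      using edge[of 0] u \<open>f u = 0\<close> step[of "snd (w ! 0)" u "vs ! Suc 0"] by simp
  next
    case (Suc i)
    then have "f (vs ! Suc i) < snd (w ! Suc i)"
      using inc[of i] by simp
    then show ?case
      using edge[of "Suc i"] Suc.prems by (intro step)
  qed
  from this[of "length w - 1"] show ?thesis
    using ne v by (simp add: arrival_time_def last_conv_nth)
qed

text \<open>The potential bounds every walk from below, so a single walk that attains
  \<open>f v\<close> determines the infimum.\<close>

lemma temporal_dist_eqI:
  assumes reach: "u \<noteq> v \<Longrightarrow> reaches_at E u v (f v)" and "f u = 0"
    and step: "\<And>x y t. 1 \<le> t \<Longrightarrow> {x, y} \<in> E t \<Longrightarrow> f x < t \<Longrightarrow> f y \<le> t"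
  shows "temporal_dist E u v = enat (f v)"
proof (cases "u = v")
  case True
  then show ?thesis
    using \<open>f u = 0\<close> by (simp add: temporal_dist_def zero_enat_def)
next
  case False
  with reach obtain w where w: "temporal_walk E u v w" "arrival_time w = f v"
    unfolding reaches_at_def by blast
  have "(INF w\<in>{w. temporal_walk E u v w}. enat (arrival_time w)) = enat (f v)"
  proof (rule antisym)
    show "(INF w\<in>{w. temporal_walk E u v w}. enat (arrival_time w)) \<le> enat (f v)"
      using w by (intro INF_lower2[of w]) auto
    show "enat (f v) \<le> (INF w\<in>{w. temporal_walk E u v w}. enat (arrival_time w))"
      using potential_le_arrival_time[of E u v _ f] assms(2) step
      by (intro INF_greatest) auto
  qed
  with False show ?thesis
    by (simp add: temporal_dist_def)
qed

text \<open>Invariant under the reflection that fixes 0 and swaps 1 with 4 and 2 with 3.\<close>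

definition C5 :: "nat \<Rightarrow> nat set set" where
  "C5 t = {{1, 2}, {3, 4}} \<union> (if 2 \<le> t then {{2, 3}} else {}) \<union>
     (if 3 \<le> t then {{0, 1}, {0, 4}} else {})"

text \<open>Rows are sources and columns are targets. The table is not symmetric: a walk from 2 can
  end in 0 at time 3, but one from 0 leaves at time 3 at the earliest and reaches 2 only at time
  4.\<close>

definition dist5 :: "nat \<Rightarrow> nat \<Rightarrow> nat" where
  "dist5 u v = [[0, 3, 4, 4, 3],
                [3, 0, 1, 2, 3],
                [3, 1, 0, 2, 3],
                [3, 3, 2, 0, 1],
                [3, 3, 2, 1, 0]] ! u ! v"

lemma lessThan_5: "{..<5} = {0, 1, 2, 3, 4 :: nat}"
  by auto

lemma temporal_cycle_C5: "temporal_cycle {..<5} C5"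
proof -
  define vs :: "nat list" where "vs = [0, 1, 2, 3, 4]"
  have "{{vs ! i, vs ! (Suc i mod length vs)} | i. i < length vs} =
      (\<lambda>i. {vs ! i, vs ! (Suc i mod 5)}) ` {..<5}"
    by (auto simp: vs_def)
  also have "\<dots> = {{0, 1}, {1, 2}, {2, 3}, {3, 4}, {4, 0}}"
    by (simp add: lessThan_5 vs_def)
  finally have edges: "{{vs ! i, vs ! (Suc i mod length vs)} | i. i < length vs} =
      {{0, 1}, {1, 2}, {2, 3}, {3, 4}, {4, 0}}" .
  have "temporal_graph {..<5} C5"
  proof
    show "C5 t \<subseteq> {e. e \<subseteq> {..<5} \<and> card e = 2}" for t
      by (auto simp: C5_def)
    show "{..<5 :: nat} \<noteq> {}"
      by (simp add: lessThan_5)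
    show "\<exists>\<tau>\<ge>1. \<forall>t\<ge>\<tau>. C5 t = C5 \<tau>"
      by (rule exI[of _ 3]) (simp add: C5_def)
  qed auto
  moreover have "underlying_edges C5 = {{0, 1}, {1, 2}, {2, 3}, {3, 4}, {4, 0}}"
  proof -
    \<comment> \<open>No edge first appears after time 3, so the union over all times is already
      attained there.\<close>
    have "C5 t \<subseteq> C5 3" for t
      by (simp add: C5_def)
    then have "underlying_edges C5 = C5 3"
      unfolding underlying_edges_def by (intro equalityI UN_least UN_upper) simp_all
    also have "\<dots> = {{0, 1}, {1, 2}, {2, 3}, {3, 4}, {4, 0}}"
      by (auto simp: C5_def)
    finally show ?thesis .
  qed
  moreover have "distinct vs" "length vs \<ge> 3" "set vs = {..<5}"
    by (simp_all add: vs_def lessThan_5)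
  ultimately show ?thesis
    unfolding temporal_cycle_def is_cycle_graph_def edges[symmetric]
    by (intro conjI exI[of _ vs] refl)
qed

lemma reaches_at_C5:
  assumes "u < 5" "v < 5" "u \<noteq> v"
  shows "reaches_at C5 u v (dist5 u v)"
proof -
  note edge = reaches_at_edge[of _ _ C5] and step = reaches_at_step[of C5]
  have r: "reaches_at C5 0 1 3" "reaches_at C5 0 4 3"
    "reaches_at C5 1 0 3" "reaches_at C5 4 0 3"
    "reaches_at C5 1 2 1" "reaches_at C5 2 1 1" "reaches_at C5 3 4 1" "reaches_at C5 4 3 1"
    "reaches_at C5 2 3 2" "reaches_at C5 3 2 2"
    by (rule edge; simp add: C5_def insert_commute)+
  have s: "reaches_at C5 0 2 4" "reaches_at C5 0 3 4"
    "reaches_at C5 1 3 2" "reaches_at C5 4 2 2"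
    "reaches_at C5 2 0 3" "reaches_at C5 3 0 3"
    "reaches_at C5 2 4 3" "reaches_at C5 3 1 3"
    by (rule step[OF r(1)] step[OF r(2)] step[OF r(5)] step[OF r(8)]
          step[OF r(6)] step[OF r(7)] step[OF r(9)] step[OF r(10)];
        simp add: C5_def insert_commute)+
  have t: "reaches_at C5 1 4 3" "reaches_at C5 4 1 3"
    by (rule step[OF s(3)] step[OF s(4)]; simp add: C5_def insert_commute)+
  have "u \<in> {0, 1, 2, 3, 4}" "v \<in> {0, 1, 2, 3, 4}"
    using assms by auto
  with assms(3) r s t show ?thesis
    by (auto simp: dist5_def)
qed

lemma temporal_dist_C5:
  assumes "u < 5" "v < 5"
  shows "temporal_dist C5 u v = enat (dist5 u v)"
\<comment> \<open>The potential is the whole row \<open>dist5 u\<close>: the claimed distances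
  certify their own lower bound.\<close>
proof (rule temporal_dist_eqI)
  have u: "u \<in> {0, 1, 2, 3, 4}"
    using assms by auto
  then show "dist5 u u = 0"
    by (auto simp: dist5_def)
  fix x y t :: nat
  assume "1 \<le> t" "{x, y} \<in> C5 t" "dist5 u x < t"
  with u show "dist5 u y \<le> t"
    by (auto simp: dist5_def C5_def doubleton_eq_iff split: if_splits)
qed (use assms in \<open>auto intro: reaches_at_C5\<close>)

text \<open>Counts along a list instead of taking the cardinality of a set, so that payoffs can be
  evaluated.\<close>

definition pay5 :: "nat \<Rightarrow> nat \<Rightarrow> nat" where
  "pay5 p q = length (filter (\<lambda>v. dist5 v p < dist5 v q) [0, 1, 2, 3, 4])"

lemma rvor_payoff_C5:
  assumes "p < 5" "q < 5"
  shows "rvor_payoff {..<5} C5 p q = pay5 p q"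
proof -
  have "rvor_won {..<5} C5 p q = {v \<in> {..<5}. dist5 v p < dist5 v q}"
    using assms by (auto simp: rvor_won_def temporal_dist_C5)
  also have "\<dots> = set (filter (\<lambda>v. dist5 v p < dist5 v q) [0, 1, 2, 3, 4])"
    by (simp only: set_filter list.set lessThan_5)
  finally have "rvor_won {..<5} C5 p q = set (filter (\<lambda>v. dist5 v p < dist5 v q) [0, 1, 2, 3, 4])" .
  then show ?thesis
    unfolding rvor_payoff_def pay5_def by (simp only: distinct_card distinct_filter distinct.simps) simp
qed

text \<open>Evaluation of all 25 profiles, equal choices included; the first disjunct is a
  profitable deviation of player 1, the second one of player 2.\<close>

lemma no_mutual_best_response_pay5:
  "\<forall>p\<in>{0, 1, 2, 3, 4}. \<forall>q\<in>{0, 1, 2, 3, 4}.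
     \<exists>p'\<in>{0, 1, 2, 3, 4}. pay5 p q < pay5 p' q \<or> pay5 q p < pay5 p' p"
  by code_simp

theorem theorem2:
  shows "\<exists>(V :: nat set) (E :: nat \<Rightarrow> nat set set).
    temporal_cycle V E \<and> monotonically_growing E \<and>
    \<not> (\<exists>p\<^sub>1 p\<^sub>2. rvor_nash V E p\<^sub>1 p\<^sub>2)"
proof (intro exI conjI)
  show "temporal_cycle {..<5} C5"
    by (rule temporal_cycle_C5)
  show "monotonically_growing C5"
    by (auto simp: monotonically_growing_def C5_def)
  show "\<not> (\<exists>p\<^sub>1 p\<^sub>2. rvor_nash {..<5} C5 p\<^sub>1 p\<^sub>2)"
  proof clarify
    fix p q
    assume nash: "rvor_nash {..<5} C5 p q"
    then have "p < 5" "q < 5"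
      by (auto simp: rvor_nash_def)
    then obtain p' where "p' < 5" "pay5 p q < pay5 p' q \<or> pay5 q p < pay5 p' p"
      using no_mutual_best_response_pay5 unfolding lessThan_5[symmetric] by auto
    with nash \<open>p < 5\<close> \<open>q < 5\<close> show False
      by (auto simp: rvor_nash_def rvor_payoff_C5 simp flip: not_less)
  qed
qed

end
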